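(* Let $r,r'\in\mathbb{Z}_2$. Then $V(2,r)\otimes V(2,r')\cong P(r+r'+1)$ as $D_4$-modules.
   Context: Let $k$ be an algebraically closed field with $\mathrm{char}(k)\neq 2$. All modules are finite-dimensional left modules; $\otimes=\otimes_k$; $\mathbb{Z}_2=\mathbb{Z}/2\mathbb{Z}$. $D_4$ is the $k$-algebra generated by $a,b,c,d$ subject to $ba=-ab$, $db=-bd$, $ca=-ac$, $dc=-cd$, $bc=cb$, $a^2=0$, $b^2=1$, $c^2=1$, $d^2=0$, $da+ad=1-bc$. It is a $16$-dimensional Hopf algebra (isomorphic to the Drinfeld double of Sweedler's 4-dimensional Hopf algebra) with comultiplication $\Delta(a)=a\otimes b+1\otimes a$, $\Delta(b)=b\otimes b$, $\Delta(c)=c\otimes c$, $\Delta(d)=d\otimes c+1\otimes d$, counit $\varepsilon(a)=\varepsilon(d)=0$, $\varepsilon(b)=\varepsilon(c)=1$, antipode $S(a)=-ab$, $S(b)=b$, $S(c)=c$, $S(d)=-dc$. Tensor products of $D_4$-modules are $D_4$-modules via $\Delta$. For $r\in\mathbb{Z}_2$: $V(2,r)$ is the simple module with basis $v_1,v_2$ and action $av_1=v_2$, $dv_1=0$, $bv_1=(-1)^rv_1$, $cv_1=(-1)^{r+1}v_1$, $av_2=0$, $dv_2=2v_1$, $bv_2=(-1)^{r+1}v_2$, $cv_2=(-1)^rv_2$. $P(r)$ is the projective cover of the one-dimensional simple module $V(r)$ on which $a,d$ act as $0$ and $b,c$ act as $(-1)^r$; explicitly, $P(r)$ has a basis $v_1,v_2,v_3,v_4$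 with $av_1=v_2$, $dv_1=v_3$, $av_2=0$, $dv_2=-v_4$, $av_3=v_4$, $dv_3=0$, $av_4=dv_4=0$, where $b$ and $c$ both act as $(-1)^r$ on $v_1,v_4$ and as $(-1)^{r+1}$ on $v_2,v_3$. *)

theory Defs
  imports
    "HOL-Analysis.Analysis"
    "HOL-Library.Poly_Mapping"
    "HOL-Library.Z2"
    "HOL-Computational_Algebra.Polynomial"
begin

section \<open>Monoid algebras and two-sided ideals\<close>

text \<open>For a monoid \<open>'m\<close> (written additively) the type \<open>'m \<Rightarrow>\<^sub>0 'k\<close> with its convolution
  product is the monoid algebra of \<open>'m\<close> over \<open>'k\<close>.\<close>

lemma poly_mapping_single_induct [case_names single add]:
  assumes "\<And>u c. Q (Poly_Mapping.single u c)"
    and "\<And>p q. Q p \<Longrightarrow> Q q \<Longrightarrow> Q (p + q)"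
  shows "Q (p :: 'm \<Rightarrow>\<^sub>0 'k::comm_monoid_add)"
proof (induction p rule: update_induct)
  case const
  show ?case using assms(1)[of undefined 0] by simp
next
  case (update f a b)
  have "Poly_Mapping.update a b f = f + Poly_Mapping.single a b"
    using update by (intro poly_mapping_eqI) (auto simp: lookup_update lookup_add lookup_single when_def in_keys_iff)
  then show ?case using assms update by simp
qed

inductive_set ideal :: "'r::ring_1 set \<Rightarrow> 'r set" for R where
  zero: "0 \<in> ideal R"
| gen: "r \<in> R \<Longrightarrow> x * r * y \<in> ideal R"
| add: "p \<in> ideal R \<Longrightarrow> q \<in> ideal R \<Longrightarrow> p + q \<in> ideal R"

lemma ideal_base: "r \<in> R \<Longrightarrow> r \<in> ideal R"
  using ideal.gen[of r R 1 1] by simp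

lemma ideal_mult_left: "p \<in> ideal R \<Longrightarrow> z * p \<in> ideal R"
proof (induction rule: ideal.induct)
  case (gen r x y)
  then show ?case using ideal.gen[of r R "z * x" y] by (simp add: mult.assoc)
qed (auto intro: ideal.intros simp: distrib_left)

lemma ideal_mult_right: "p \<in> ideal R \<Longrightarrow> p * z \<in> ideal R"
proof (induction rule: ideal.induct)
  case (gen r x y)
  then show ?case using ideal.gen[of r R x "y * z"] by (simp add: mult.assoc)
qed (auto intro: ideal.intros simp: distrib_right)

lemma ideal_uminus: "p \<in> ideal R \<Longrightarrow> - p \<in> ideal R"
  using ideal_mult_left[of p R "- 1"] by simp

definition ideal_cong :: "'r::ring_1 set \<Rightarrow> 'r \<Rightarrow> 'r \<Rightarrow> bool" where
  "ideal_cong R p q \<longleftrightarrow> p - q \<in> ideal R"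

lemma ideal_cong_equivp: "equivp (ideal_cong R)"
proof (rule equivpI)
  show "reflp (ideal_cong R)" by (auto simp: reflp_def ideal_cong_def ideal.zero)
  show "symp (ideal_cong R)"
    using ideal_uminus by (fastforce simp: symp_def ideal_cong_def)
  show "transp (ideal_cong R)"
    unfolding transp_def ideal_cong_def using ideal.add by fastforce
qed

lemma ideal_cong_add: "ideal_cong R p p' \<Longrightarrow> ideal_cong R q q' \<Longrightarrow> ideal_cong R (p + q) (p' + q')"
  unfolding ideal_cong_def using ideal.add[of "p - p'" R "q - q'"] by (simp add: algebra_simps)

lemma ideal_cong_uminus: "ideal_cong R p p' \<Longrightarrow> ideal_cong R (- p) (- p')"
  unfolding ideal_cong_def using ideal_uminus[of "p - p'" R] by (simp add: algebra_simps)

lemma ideal_cong_diff: "ideal_cong R p p' \<Longrightarrow> ideal_cong R q q' \<Longrightarrow> ideal_cong R (p - q) (p' - q')"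
  using ideal_cong_add[of R p p' "- q" "- q'"] ideal_cong_uminus[of R q q'] by simp

lemma ideal_cong_mult:
  assumes "ideal_cong R p p'" "ideal_cong R q q'"
  shows "ideal_cong R (p * q) (p' * q')"
proof -
  have "p * q - p' * q' = (p - p') * q + p' * (q - q')" by (simp add: algebra_simps)
  then show ?thesis
    using assms ideal.add ideal_mult_left ideal_mult_right unfolding ideal_cong_def by metis
qed

lemma ideal_congI: "p - q \<in> R \<Longrightarrow> ideal_cong R p q"
  by (simp add: ideal_cong_def ideal_base)

subsection \<open>Evaluation of elements of a monoid algebra\<close>

definition pm_eval :: "('k \<Rightarrow> 'r) \<Rightarrow> ('m \<Rightarrow> 'r) \<Rightarrow> ('m::monoid_add \<Rightarrow>\<^sub>0 'k::field) \<Rightarrow> 'r::ring_1" where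
  "pm_eval \<eta> h p = (\<Sum>u \<in> Poly_Mapping.keys p. \<eta> (Poly_Mapping.lookup p u) * h u)"

definition central_hom :: "('k::field \<Rightarrow> 'r::ring_1) \<Rightarrow> bool" where
  "central_hom \<eta> \<longleftrightarrow> \<eta> 1 = 1 \<and> (\<forall>c d. \<eta> (c + d) = \<eta> c + \<eta> d) \<and> (\<forall>c d. \<eta> (c * d) = \<eta> c * \<eta> d)
     \<and> (\<forall>c x. \<eta> c * x = x * \<eta> c)"

lemma central_hom_add: "central_hom \<eta> \<Longrightarrow> \<eta> (c + d) = \<eta> c + \<eta> d"
  and central_hom_mult: "central_hom \<eta> \<Longrightarrow> \<eta> (c * d) = \<eta> c * \<eta> d"
  and central_hom_one: "central_hom \<eta> \<Longrightarrow> \<eta> 1 = 1"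
  and central_hom_commute: "central_hom \<eta> \<Longrightarrow> \<eta> c * x = x * \<eta> c"
  unfolding central_hom_def by blast+

lemma central_hom_zero: "central_hom \<eta> \<Longrightarrow> \<eta> 0 = 0"
  unfolding central_hom_def by (metis add_cancel_right_right)

definition monoid_morphism :: "('m::monoid_add \<Rightarrow> 'r::monoid_mult) \<Rightarrow> bool" where
  "monoid_morphism h \<longleftrightarrow> h 0 = 1 \<and> (\<forall>u w. h (u + w) = h u * h w)"

lemma pm_eval_single:
  "central_hom \<eta> \<Longrightarrow> pm_eval \<eta> h (Poly_Mapping.single u c) = \<eta> c * h u"
  by (simp add: pm_eval_def central_hom_zero)

lemma pm_eval_add:
  assumes "central_hom \<eta>"
  shows "pm_eval \<eta> h (p + q) = pm_eval \<eta> h p + pm_eval \<eta> h q"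
  unfolding pm_eval_def
  by (intro setsum_keys_plus_distrib[of "\<lambda>u c. \<eta> c * h u"])
     (simp_all add: central_hom_zero[OF assms] central_hom_add[OF assms] distrib_right)

lemma pm_eval_zero [simp]: "pm_eval \<eta> h 0 = 0"
  by (simp add: pm_eval_def)

lemma pm_eval_uminus:
  assumes "central_hom \<eta>"
  shows "pm_eval \<eta> h (- p) = - pm_eval \<eta> h p"
  using pm_eval_add[OF assms, of h p "- p"] by (simp add: add_eq_0_iff)

lemma pm_eval_diff:
  assumes "central_hom \<eta>"
  shows "pm_eval \<eta> h (p - q) = pm_eval \<eta> h p - pm_eval \<eta> h q"
  using pm_eval_add[OF assms, of h p "- q"] pm_eval_uminus[OF assms] by simp

lemma pm_eval_one:
  assumes "central_hom \<eta>" "monoid_morphism h"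
  shows "pm_eval \<eta> h 1 = 1"
  using pm_eval_single[OF assms(1), of h 0 1] assms by (simp add: central_hom_one monoid_morphism_def)

lemma pm_eval_mult:
  assumes "central_hom \<eta>" "monoid_morphism h"
  shows "pm_eval \<eta> h (p * q) = pm_eval \<eta> h p * pm_eval \<eta> h q"
proof (induction p rule: poly_mapping_single_induct)
  case (single u c)
  show ?case
  proof (induction q rule: poly_mapping_single_induct)
    case (single w d)
    have "\<eta> c * \<eta> d * (h u * h w) = \<eta> c * (\<eta> d * h u) * h w" by (simp only: mult.assoc)
    also have "\<dots> = \<eta> c * h u * (\<eta> d * h w)"
      by (simp only: central_hom_commute[OF assms(1), of d "h u"] mult.assoc)
    finally show ?case
      using assms(2)
      by (simp add: mult_single pm_eval_single[OF assms(1)] central_hom_mult[OF assms(1)] monoid_morphism_def)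
  next
    case (add p q)
    then show ?case by (simp add: distrib_left pm_eval_add[OF assms(1)])
  qed
next
  case (add p q)
  then show ?case by (simp add: distrib_right pm_eval_add[OF assms(1)])
qed

lemma pm_eval_ideal_cong:
  assumes "central_hom \<eta>" "monoid_morphism h" "\<And>r. r \<in> R \<Longrightarrow> pm_eval \<eta> h r = 0"
    and "ideal_cong R p q"
  shows "pm_eval \<eta> h p = pm_eval \<eta> h q"
proof -
  have "pm_eval \<eta> h r = 0" if "r \<in> ideal R" for r
    using that by induction (simp_all add: pm_eval_add pm_eval_mult assms)
  from this[OF assms(4)[unfolded ideal_cong_def]] show ?thesis
    by (simp add: pm_eval_diff[OF assms(1)])
qed

subsection \<open>Action of a monoid algebra on \<open>'k^'n\<close>\<close>

abbreviation linear_map :: "('k::field^'n::finite \<Rightarrow> 'k^'m::finite) \<Rightarrow> bool" where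
  "linear_map \<equiv> Vector_Spaces.linear (*s) (*s)"

lemma linear_mapI:
  assumes "\<And>v w. f (v + w) = f v + f w" "\<And>c v. f (c *s v) = c *s f v"
  shows "linear_map f"
  using assms by unfold_locales auto

lemma linear_map_add: "linear_map f \<Longrightarrow> f (v + w) = f v + f w"
  by (rule vec.linear_add)

lemma linear_map_scale: "linear_map f \<Longrightarrow> f (c *s v) = c *s f v"
  by (rule vec.linear_scale)

lemma linear_map_sum: "linear_map f \<Longrightarrow> f (sum g S) = (\<Sum>x\<in>S. f (g x))"
  by (rule vec.linear_sum)

lemma linear_map_zero: "linear_map f \<Longrightarrow> f 0 = 0"
  by (rule vec.linear_0)

definition pm_act :: "('m \<Rightarrow> 'k^'n \<Rightarrow> 'k^'n) \<Rightarrow> ('m::monoid_add \<Rightarrow>\<^sub>0 'k::field) \<Rightarrow> 'k^'n \<Rightarrow> 'k^'n::finite" where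
  "pm_act h p v = (\<Sum>u \<in> Poly_Mapping.keys p. Poly_Mapping.lookup p u *s h u v)"

definition monoid_action :: "('m::monoid_add \<Rightarrow> 'k::field^'n::finite \<Rightarrow> 'k^'n) \<Rightarrow> bool" where
  "monoid_action h \<longleftrightarrow> (\<forall>u. linear_map (h u)) \<and> (\<forall>v. h 0 v = v) \<and> (\<forall>u w v. h (u + w) v = h u (h w v))"

lemma pm_act_single: "pm_act h (Poly_Mapping.single u c) v = c *s h u v"
  by (simp add: pm_act_def)

lemma pm_act_add: "pm_act h (p + q) v = pm_act h p v + pm_act h q v"
  unfolding pm_act_def
  by (intro setsum_keys_plus_distrib[of "\<lambda>u c. c *s h u v"]) (simp_all add: vec.scale_left_distrib)

lemma pm_act_zero [simp]: "pm_act h 0 v = 0"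
  by (simp add: pm_act_def)

lemma pm_act_uminus: "pm_act h (- p) v = - pm_act h p v"
  using pm_act_add[of h p "- p" v] by (simp add: add_eq_0_iff)

lemma pm_act_diff: "pm_act h (p - q) v = pm_act h p v - pm_act h q v"
  using pm_act_add[of h p "- q" v] pm_act_uminus by simp

lemma pm_act_one: "monoid_action h \<Longrightarrow> pm_act h 1 v = v"
  using pm_act_single[of h 0 1 v] by (simp add: monoid_action_def)

lemma pm_act_linear:
  assumes "monoid_action h"
  shows "linear_map (pm_act h p)"
proof -
  have h: "linear_map (h u)" for u using assms unfolding monoid_action_def by blast
  show ?thesis
    by (rule linear_mapI)
       (simp_all add: pm_act_def linear_map_add[OF h] linear_map_scale[OF h] vec.scale_right_distrib
         sum.distrib vec.scale_sum_right mult.commute)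
qed

lemma pm_act_mult:
  assumes h: "monoid_action h"
  shows "pm_act h (p * q) v = pm_act h p (pm_act h q v)"
proof (induction p rule: poly_mapping_single_induct)
  case (single u c)
  show ?case
  proof (induction q rule: poly_mapping_single_induct)
    case (single w d)
    show ?case
    proof -
      have lin: "linear_map (h u)" and mul: "h (u + w) v = h u (h w v)"
        using h unfolding monoid_action_def by blast+
      show ?thesis by (simp add: mult_single pm_act_single linear_map_scale[OF lin] mul)
    qed
  next
    case (add p q)
    then show ?case
      using linear_map_add[OF pm_act_linear[OF h]] by (simp add: distrib_left pm_act_add)
  qed
next
  case (add p q)
  then show ?case by (simp add: distrib_right pm_act_add)
qed

lemma pm_act_ideal_cong:
  assumes h: "monoid_action h" and "\<And>r v. r \<in> R \<Longrightarrow> pm_act h r v = 0"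
    and "ideal_cong R p q"
  shows "pm_act h p v = pm_act h q v"
proof -
  have "\<forall>v. pm_act h r v = 0" if "r \<in> ideal R" for r
    using that by induction
      (simp_all add: pm_act_add pm_act_mult[OF h] assms(2) linear_map_zero[OF pm_act_linear[OF h]])
  from this[OF assms(3)[unfolded ideal_cong_def]] show ?thesis
    by (simp add: pm_act_diff)
qed

section \<open>The algebra \<open>D\<^sub>4\<close>\<close>

datatype gen = A | B | C | D

datatype word = Word (letters: "gen list")

instantiation word :: monoid_add
begin
definition "0 = Word []"
definition "u + w = Word (letters u @ letters w)"
instance by standard (auto simp: zero_word_def plus_word_def)
end

abbreviation letter :: "gen \<Rightarrow> word \<Rightarrow>\<^sub>0 'k::field" where
  "letter g \<equiv> Poly_Mapping.single (Word [g]) 1"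

text \<open>Each relation \<open>l = r\<close> is recorded as the difference \<open>l - r\<close>.\<close>

definition D4_relations :: "(word \<Rightarrow>\<^sub>0 'k::field) set" where
  "D4_relations = (let a = letter A; b = letter B; c = letter C; d = letter D in
     {b * a - (- (a * b)), d * b - (- (b * d)), c * a - (- (a * c)), d * c - (- (c * d)),
      b * c - c * b, a * a - 0, b * b - 1, c * c - 1, d * d - 0, (d * a + a * d) - (1 - b * c)})"

quotient_type (overloaded) 'k D4 = "word \<Rightarrow>\<^sub>0 'k::field" / "ideal_cong D4_relations"
  by (rule ideal_cong_equivp)

definition word_prod :: "(gen \<Rightarrow> 'r::monoid_mult) \<Rightarrow> word \<Rightarrow> 'r" where
  "word_prod g w = prod_list (map g (letters w))"

lemma word_prod_morphism: "monoid_morphism (word_prod g)"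
  by (simp add: monoid_morphism_def word_prod_def zero_word_def plus_word_def)

lemma central_hom_id: "central_hom (id :: 'k::field \<Rightarrow> 'k)"
  by (simp add: central_hom_def mult.commute)

lift_definition counit :: "'k::field D4 \<Rightarrow> 'k"
  is "pm_eval id (word_prod (\<lambda>g. case g of A \<Rightarrow> 0 | B \<Rightarrow> 1 | C \<Rightarrow> 1 | D \<Rightarrow> 0))"
proof (rule pm_eval_ideal_cong[OF central_hom_id word_prod_morphism])
  fix r :: "word \<Rightarrow>\<^sub>0 'k" assume "r \<in> D4_relations"
  then show "pm_eval id (word_prod (\<lambda>g. case g of A \<Rightarrow> 0 | B \<Rightarrow> 1 | C \<Rightarrow> 1 | D \<Rightarrow> 0)) r = 0"
    by (auto simp: D4_relations_def Let_def pm_eval_add[OF central_hom_id] pm_eval_diff[OF central_hom_id] pm_eval_uminus[OF central_hom_id]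
        pm_eval_mult[OF central_hom_id word_prod_morphism] pm_eval_single[OF central_hom_id] pm_eval_one[OF central_hom_id word_prod_morphism] word_prod_def)
qed

instantiation D4 :: (field) ring_1
begin

lift_definition zero_D4 :: "'a D4" is 0 .
lift_definition one_D4 :: "'a D4" is 1 .
lift_definition plus_D4 :: "'a D4 \<Rightarrow> 'a D4 \<Rightarrow> 'a D4" is "(+)" by (rule ideal_cong_add)
lift_definition uminus_D4 :: "'a D4 \<Rightarrow> 'a D4" is uminus by (rule ideal_cong_uminus)
lift_definition minus_D4 :: "'a D4 \<Rightarrow> 'a D4 \<Rightarrow> 'a D4" is "(-)" by (rule ideal_cong_diff)
lift_definition times_D4 :: "'a D4 \<Rightarrow> 'a D4 \<Rightarrow> 'a D4" is "(*)" by (rule ideal_cong_mult)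

instance
proof
  have "counit (0 :: 'a D4) = 0" by transfer simp
  moreover have "counit (1 :: 'a D4) = 1"
    by transfer (rule pm_eval_one[OF central_hom_id word_prod_morphism])
  ultimately show "(0 :: 'a D4) \<noteq> 1" by force
qed (transfer, simp add: algebra_simps ideal_cong_def ideal.zero)+

end

lift_definition D4_gen :: "gen \<Rightarrow> 'k::field D4" is letter .

text \<open>The structure map \<open>k \<rightarrow> D\<^sub>4\<close>, \<open>c \<mapsto> c \<cdot> 1\<close>.\<close>

lift_definition D4_scalar :: "'k::field \<Rightarrow> 'k D4" is "Poly_Mapping.single 0" .

lemma single_zero_central:
  "Poly_Mapping.single (0::'m::monoid_add) c * p = p * Poly_Mapping.single 0 (c::'k::field)"
  by (induction p rule: poly_mapping_single_induct)
     (simp_all add: mult_single distrib_left distrib_right mult.commute)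

lemma D4_scalar_central_hom: "central_hom D4_scalar"
  unfolding central_hom_def
proof (intro conjI allI)
  show "D4_scalar 1 = 1" by transfer (simp add: ideal_cong_def ideal.zero)
  show "D4_scalar (c + d) = D4_scalar c + D4_scalar d" for c d :: 'a
    by transfer (simp add: single_add ideal_cong_def ideal.zero)
  show "D4_scalar (c * d) = D4_scalar c * D4_scalar d" for c d :: 'a
    by transfer (simp add: mult_single ideal_cong_def ideal.zero)
  show "D4_scalar c * x = x * D4_scalar c" for c :: 'a and x
    by transfer (simp add: single_zero_central ideal_cong_def ideal.zero)
qed

lemma D4_rels:
  fixes a b c d :: "'k::field D4"
  defines "a \<equiv> D4_gen A" and "b \<equiv> D4_gen B" and "c \<equiv> D4_gen C" and "d \<equiv> D4_gen D"
  shows "b * a = - (a * b)" "d * b = - (b * d)" "c * a = - (a * c)" "d * c = - (c * d)"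
    "b * c = c * b" "a * a = 0" "b * b = 1" "c * c = 1" "d * d = 0" "d * a + a * d = 1 - b * c"
  unfolding assms
  by (transfer, rule ideal_congI, simp add: D4_relations_def Let_def)+

lemma counit_mult: "counit (x * y) = counit x * counit y"
  by transfer (rule pm_eval_mult[OF central_hom_id word_prod_morphism])

lemma counit_add: "counit (x + y) = counit x + counit y"
  by transfer (rule pm_eval_add[OF central_hom_id])

lemma counit_one: "counit 1 = 1"
  by transfer (rule pm_eval_one[OF central_hom_id word_prod_morphism])

lemma counit_scalar: "counit (D4_scalar c) = c"
  by transfer (simp add: pm_eval_single[OF central_hom_id] word_prod_def zero_word_def)

section \<open>The tensor square \<open>D\<^sub>4 \<otimes> D\<^sub>4\<close> and the comultiplication\<close>

text \<open>\<open>D\<^sub>4 \<otimes> D\<^sub>4\<close> is the free vector space on the pairs \<open>(x, y)\<close> modulo the bilinearity relations,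
  with product \<open>(x \<otimes> y)(x' \<otimes> y') = xx' \<otimes> yy'\<close>. The free space on pairs is the monoid algebra of
  the multiplicative monoid of pairs, in which the bilinearity relations span an ideal.\<close>

datatype 'r pure = Pure 'r 'r

instantiation pure :: (monoid_mult) monoid_add
begin
definition "0 = Pure 1 1"
fun plus_pure :: "'a pure \<Rightarrow> 'a pure \<Rightarrow> 'a pure" where
  "plus_pure (Pure x y) (Pure x' y') = Pure (x * x') (y * y')"
instance
proof
  fix u v w :: "'a pure"
  show "u + v + w = u + (v + w)" by (cases u; cases v; cases w) (simp add: mult.assoc)
  show "0 + u = u" "u + 0 = u" by (cases u, simp add: zero_pure_def)+
qed
end

abbreviation pure_tensor :: "'k::field D4 \<Rightarrow> 'k D4 \<Rightarrow> 'k D4 pure \<Rightarrow>\<^sub>0 'k" where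
  "pure_tensor x y \<equiv> Poly_Mapping.single (Pure x y) 1"

definition bilinear_relations :: "('k::field D4 pure \<Rightarrow>\<^sub>0 'k) set" where
  "bilinear_relations =
     {pure_tensor (x + x') y - (pure_tensor x y + pure_tensor x' y) | x x' y. True} \<union>
     {pure_tensor x (y + y') - (pure_tensor x y + pure_tensor x y') | x y y'. True} \<union>
     {pure_tensor (D4_scalar c * x) y - Poly_Mapping.single (Pure x y) c | c x y. True} \<union>
     {pure_tensor x (D4_scalar c * y) - Poly_Mapping.single (Pure x y) c | c x y. True}"

quotient_type (overloaded) 'k D4_tensor = "'k::field D4 pure \<Rightarrow>\<^sub>0 'k" / "ideal_cong bilinear_relations"
  by (rule ideal_cong_equivp)

lift_definition counit_tensor :: "'k::field D4_tensor \<Rightarrow> 'k"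
  is "pm_eval id (\<lambda>u. case u of Pure x y \<Rightarrow> counit x * counit y)"
proof (rule pm_eval_ideal_cong[OF central_hom_id])
  show "monoid_morphism (\<lambda>u. case u of Pure x y \<Rightarrow> counit x * counit (y :: 'k D4))"
    by (auto simp: monoid_morphism_def zero_pure_def counit_one counit_mult split: pure.splits)
  fix r :: "'k D4 pure \<Rightarrow>\<^sub>0 'k" assume "r \<in> bilinear_relations"
  then show "pm_eval id (\<lambda>u. case u of Pure x y \<Rightarrow> counit x * counit y) r = 0"
    by (auto simp: bilinear_relations_def pm_eval_add[OF central_hom_id] pm_eval_diff[OF central_hom_id]
        pm_eval_single[OF central_hom_id] counit_mult counit_add counit_scalar distrib_left distrib_right mult.left_commute mult.assoc)
qed

instantiation D4_tensor :: (field) ring_1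
begin

lift_definition zero_D4_tensor :: "'a D4_tensor" is 0 .
lift_definition one_D4_tensor :: "'a D4_tensor" is 1 .
lift_definition plus_D4_tensor :: "'a D4_tensor \<Rightarrow> 'a D4_tensor \<Rightarrow> 'a D4_tensor" is "(+)"
  by (rule ideal_cong_add)
lift_definition uminus_D4_tensor :: "'a D4_tensor \<Rightarrow> 'a D4_tensor" is uminus
  by (rule ideal_cong_uminus)
lift_definition minus_D4_tensor :: "'a D4_tensor \<Rightarrow> 'a D4_tensor \<Rightarrow> 'a D4_tensor" is "(-)"
  by (rule ideal_cong_diff)
lift_definition times_D4_tensor :: "'a D4_tensor \<Rightarrow> 'a D4_tensor \<Rightarrow> 'a D4_tensor" is "(*)"
  by (rule ideal_cong_mult)

instance
proof
  have "counit_tensor (0 :: 'a D4_tensor) = 0" by transfer simp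
  moreover have "counit_tensor (1 :: 'a D4_tensor) = 1"
    by transfer (simp add: pm_eval_single[OF central_hom_id] zero_pure_def counit_one flip: single_one)
  ultimately show "(0 :: 'a D4_tensor) \<noteq> 1" by force
qed (transfer, simp add: algebra_simps ideal_cong_def ideal.zero)+

end

lift_definition tensor :: "'k::field D4 \<Rightarrow> 'k D4 \<Rightarrow> 'k D4_tensor" (infixr "\<otimes>" 75)
  is pure_tensor .

lift_definition tensor_scalar :: "'k::field \<Rightarrow> 'k D4_tensor" is "Poly_Mapping.single 0" .

lemma tensor_scalar_central_hom: "central_hom tensor_scalar"
  unfolding central_hom_def
proof (intro conjI allI)
  show "tensor_scalar 1 = 1" by transfer (simp add: ideal_cong_def ideal.zero)
  show "tensor_scalar (c + d) = tensor_scalar c + tensor_scalar d" for c d :: 'a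
    by transfer (simp add: single_add ideal_cong_def ideal.zero)
  show "tensor_scalar (c * d) = tensor_scalar c * tensor_scalar d" for c d :: 'a
    by transfer (simp add: mult_single ideal_cong_def ideal.zero)
  show "tensor_scalar c * x = x * tensor_scalar c" for c :: 'a and x
    by transfer (simp add: single_zero_central ideal_cong_def ideal.zero)
qed

lemma tensor_add_left: "(x + x') \<otimes> y = x \<otimes> y + x' \<otimes> y"
  by transfer (rule ideal_congI, unfold bilinear_relations_def, blast)

lemma tensor_add_right: "x \<otimes> (y + y') = x \<otimes> y + x \<otimes> y'"
  by transfer (rule ideal_congI, unfold bilinear_relations_def, blast)

lemma tensor_scalar_left: "(D4_scalar c * x) \<otimes> y = tensor_scalar c * (x \<otimes> y)"
  by transfer (rule ideal_congI, unfold bilinear_relations_def mult_single add_0_left mult_1_right, blast)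

lemma tensor_scalar_right: "x \<otimes> (D4_scalar c * y) = tensor_scalar c * (x \<otimes> y)"
  by transfer (rule ideal_congI, unfold bilinear_relations_def mult_single add_0_left mult_1_right, blast)

lemma tensor_mult: "(x \<otimes> y) * (x' \<otimes> y') = (x * x') \<otimes> (y * y')"
  by transfer (simp add: mult_single ideal_cong_def ideal.zero)

lemma tensor_one: "1 \<otimes> 1 = 1"
  by transfer (unfold zero_pure_def[symmetric] single_one ideal_cong_def, simp add: ideal.zero)

lemma tensor_zero_left [simp]: "0 \<otimes> y = 0"
  using tensor_add_left[of 0 0 y] by simp

lemma tensor_zero_right [simp]: "x \<otimes> 0 = 0"
  using tensor_add_right[of x 0 0] by simp

lemma tensor_uminus_left: "(- x) \<otimes> y = - (x \<otimes> y)"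
  using tensor_add_left[of x "- x" y] by (simp add: add_eq_0_iff)

lemma tensor_uminus_right: "x \<otimes> (- y) = - (x \<otimes> y)"
  using tensor_add_right[of x y "- y"] by (simp add: add_eq_0_iff)

lemma tensor_diff_left: "(x - x') \<otimes> y = x \<otimes> y - x' \<otimes> y"
  using tensor_add_left[of x "- x'" y] by (simp add: tensor_uminus_left)

lemma tensor_diff_right: "x \<otimes> (y - y') = x \<otimes> y - x \<otimes> y'"
  using tensor_add_right[of x y "- y'"] by (simp add: tensor_uminus_right)

definition comult_gen :: "gen \<Rightarrow> 'k::field D4_tensor" where
  "comult_gen g = (let a = D4_gen A; b = D4_gen B; c = D4_gen C; d = D4_gen D in
     case g of A \<Rightarrow> a \<otimes> b + 1 \<otimes> a
             | B \<Rightarrow> b \<otimes> b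
             | C \<Rightarrow> c \<otimes> c
             | D \<Rightarrow> d \<otimes> c + 1 \<otimes> d)"

lemma comult_gen_relations:
  fixes a b c d :: "'k::field D4_tensor"
  defines "a \<equiv> comult_gen A" and "b \<equiv> comult_gen B" and "c \<equiv> comult_gen C" and "d \<equiv> comult_gen D"
  shows "b * a = - (a * b)" "d * b = - (b * d)" "c * a = - (a * c)" "d * c = - (c * d)"
    "b * c = c * b" "a * a = 0" "b * b = 1" "c * c = 1" "d * d = 0" "d * a + a * d = 1 - b * c"
proof -
  let ?a = "D4_gen A :: 'k D4" and ?b = "D4_gen B :: 'k D4"
    and ?c = "D4_gen C :: 'k D4" and ?d = "D4_gen D :: 'k D4"
  note gens = assms comult_gen_def
  note expand = gens Let_def gen.case distrib_left distrib_right tensor_mult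
  note [simp] = tensor_uminus_left tensor_uminus_right
  have da: "?d * ?a = 1 - ?b * ?c - ?a * ?d" using D4_rels(10) by (metis add_diff_cancel_right')
  show "b * a = - (a * b)" "d * b = - (b * d)" "c * a = - (a * c)" "d * c = - (c * d)"
    "b * c = c * b" "a * a = 0" "b * b = 1" "c * c = 1" "d * d = 0"
    by (simp_all add: expand D4_rels tensor_one)
  show "d * a + a * d = 1 - b * c"
    by (simp add: expand D4_rels da tensor_diff_left tensor_diff_right tensor_one)
qed

lift_definition comult :: "'k::field D4 \<Rightarrow> 'k D4_tensor"
  is "pm_eval tensor_scalar (word_prod comult_gen)"
proof (rule pm_eval_ideal_cong[OF tensor_scalar_central_hom word_prod_morphism])
  fix r :: "word \<Rightarrow>\<^sub>0 'k" assume "r \<in> D4_relations"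
  note c = tensor_scalar_central_hom
  have [simp]: "tensor_scalar 1 = 1" using c unfolding central_hom_def by blast
  show "pm_eval tensor_scalar (word_prod comult_gen) r = 0"
    using \<open>r \<in> D4_relations\<close>
    by (auto simp: D4_relations_def Let_def pm_eval_add[OF c] pm_eval_diff[OF c] pm_eval_uminus[OF c]
        pm_eval_mult[OF c word_prod_morphism] pm_eval_single[OF c] pm_eval_one[OF c word_prod_morphism]
        word_prod_def comult_gen_relations)
qed

lemma comult_add: "comult (x + y) = comult x + comult y"
  by transfer (rule pm_eval_add[OF tensor_scalar_central_hom])

lemma comult_mult: "comult (x * y) = comult x * comult y"
  by transfer (rule pm_eval_mult[OF tensor_scalar_central_hom word_prod_morphism])

lemma comult_one: "comult 1 = 1"
  by transfer (rule pm_eval_one[OF tensor_scalar_central_hom word_prod_morphism])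

lemma comult_scalar: "comult (D4_scalar c) = tensor_scalar c"
  by transfer (simp add: pm_eval_single[OF tensor_scalar_central_hom] word_prod_def zero_word_def)

lemma comult_of_gen: "comult (D4_gen g) = comult_gen g"
proof -
  have [simp]: "tensor_scalar 1 = 1" using tensor_scalar_central_hom unfolding central_hom_def by blast
  show ?thesis
    by transfer (simp add: pm_eval_single[OF tensor_scalar_central_hom] word_prod_def)
qed

section \<open>Finite-dimensional \<open>D\<^sub>4\<close>-modules\<close>

text \<open>The underlying vector space of a module is \<open>'k^'n\<close>; the last condition says that the scalars
  of \<open>D\<^sub>4\<close> act by the scalar multiplication of \<open>'k^'n\<close>.\<close>

definition is_D4_action :: "('k::field D4 \<Rightarrow> 'k^'n \<Rightarrow> 'k^'n::finite) \<Rightarrow> bool" where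
  "is_D4_action f \<longleftrightarrow>
     (\<forall>x v w. f x (v + w) = f x v + f x w) \<and> (\<forall>x y v. f (x + y) v = f x v + f y v) \<and>
     (\<forall>x y v. f (x * y) v = f x (f y v)) \<and> (\<forall>v. f 1 v = v) \<and>
     (\<forall>c v. f (D4_scalar c) v = c *s v)"

typedef (overloaded) ('k, 'n) D4_module = "{f :: 'k::field D4 \<Rightarrow> 'k^'n \<Rightarrow> 'k^'n::finite. is_D4_action f}"
  morphisms act Abs_D4_module
proof
  show "(\<lambda>x v. counit x *s v) \<in> {f :: 'k D4 \<Rightarrow> 'k^'n \<Rightarrow> 'k^'n. is_D4_action f}"
    by (simp add: is_D4_action_def counit_add counit_mult counit_one counit_scalar
        vec.scale_left_distrib vec.scale_right_distrib)
qed

lemma act_add: "act M (x + y) v = act M x v + act M y v"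
  and act_mult: "act M (x * y) v = act M x (act M y v)"
  and act_one: "act M 1 v = v"
  and act_scalar: "act M (D4_scalar c) v = c *s v"
  using act[of M] unfolding is_D4_action_def by blast+

lemma act_zero: "act M 0 v = 0"
  using act_add[of M 0 0 v] by simp

lemma act_uminus: "act M (- x) v = - act M x v"
  using act_add[of M x "- x" v] by (simp add: act_zero add_eq_0_iff)

lemma act_diff: "act M (x - y) v = act M x v - act M y v"
  using act_add[of M x "- y" v] by (simp add: act_uminus)

lemma act_relations:
  fixes M :: "('k::field, 'n::finite) D4_module"
  defines "a \<equiv> act M (D4_gen A)" and "b \<equiv> act M (D4_gen B)" and "c \<equiv> act M (D4_gen C)" and "d \<equiv> act M (D4_gen D)"
  shows "b (a v) = - a (b v)" "d (b v) = - b (d v)" "c (a v) = - a (c v)" "d (c v) = - c (d v)"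
    "b (c v) = c (b v)" "a (a v) = 0" "b (b v) = v" "c (c v) = v" "d (d v) = 0"
    "d (a v) + a (d v) = v - b (c v)"
  unfolding assms act_mult[symmetric] D4_rels(1-9)
  by (simp_all add: act_uminus act_zero act_one D4_rels(5) D4_rels(10) act_diff flip: act_add)

lemma act_linear: "linear_map (act M x)"
proof (rule linear_mapI)
  show "act M x (v + w) = act M x v + act M x w" for v w
    using act[of M] unfolding is_D4_action_def by blast
  have "D4_scalar c * x = x * D4_scalar c" for c
    using D4_scalar_central_hom unfolding central_hom_def by blast
  then show "act M x (c *s v) = c *s act M x v" for c v
    by (metis act_mult act_scalar)
qed

lemma act_fun:
  "act M (x + y) = (\<lambda>v. act M x v + act M y v)" "act M (x * y) = (\<lambda>v. act M x (act M y v))"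
  "act M 1 = (\<lambda>v. v)" "act M (D4_scalar c) = (\<lambda>v. c *s v)"
  by (simp_all add: fun_eq_iff act_add act_mult act_one act_scalar)

definition D4_hom :: "('k::field, 'n::finite) D4_module \<Rightarrow> ('k, 'm::finite) D4_module \<Rightarrow> ('k^'n \<Rightarrow> 'k^'m) \<Rightarrow> bool" where
  "D4_hom M N f \<longleftrightarrow> linear_map f \<and> (\<forall>x v. f (act M x v) = act N x (f v))"

definition D4_isomorphic :: "('k::field, 'n::finite) D4_module \<Rightarrow> ('k, 'm::finite) D4_module \<Rightarrow> bool"
    (infix "\<cong>\<^sub>D" 50) where
  "M \<cong>\<^sub>D N \<longleftrightarrow> (\<exists>f. D4_hom M N f \<and> bij f)"

subsection \<open>Tensor products\<close>

text \<open>\<open>'k^'n \<otimes> 'k^'m\<close> is \<open>'k^('n \<times> 'm)\<close>, with pure tensors \<open>v \<otimes> w = (v\<^sub>i w\<^sub>j)\<^sub>i\<^sub>j\<close>.\<close>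

definition vtensor :: "'k::field^'n::finite \<Rightarrow> 'k^'m::finite \<Rightarrow> 'k^('n \<times> 'm)" where
  "vtensor v w = (\<chi> ij. v $ fst ij * w $ snd ij)"

definition map_tensor ::
    "('k^'n \<Rightarrow> 'k^'n) \<Rightarrow> ('k^'m \<Rightarrow> 'k^'m) \<Rightarrow> 'k::field^('n::finite \<times> 'm::finite) \<Rightarrow> 'k^('n \<times> 'm)" where
  "map_tensor f g u = (\<Sum>ij\<in>UNIV. u $ ij *s vtensor (f (axis (fst ij) 1)) (g (axis (snd ij) 1)))"

lemma vtensor_add_left: "vtensor (v + v') w = vtensor v w + vtensor v' w"
  and vtensor_add_right: "vtensor v (w + w') = vtensor v w + vtensor v w'"
  and vtensor_scale_left: "vtensor (c *s v) w = c *s vtensor v w"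
  and vtensor_scale_right: "vtensor v (c *s w) = c *s vtensor v w"
  by (simp_all add: vtensor_def vec_eq_iff algebra_simps)

lemma vtensor_axis: "vtensor (axis i 1) (axis j 1) = axis (i, j) 1"
  by (auto simp: vtensor_def vec_eq_iff axis_def)

lemma vec_expand: "v = (\<Sum>i\<in>UNIV. v $ i *s axis i (1::'k::field))"
  by (rule basis_expansion[symmetric])

lemma linear_map_eq_axis:
  assumes "linear_map f" "linear_map g" "\<And>i. f (axis i 1) = g (axis i 1)"
  shows "f v = g v"
  by (subst (1 2) vec_expand[of v])
     (simp add: assms(3) linear_map_sum[OF assms(1)] linear_map_sum[OF assms(2)]
       linear_map_scale[OF assms(1)] linear_map_scale[OF assms(2)])

lemma map_tensor_linear: "linear_map (map_tensor f g)"
  by (rule linear_mapI)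
     (simp_all add: map_tensor_def vec.scale_left_distrib sum.distrib vec.scale_sum_right)

lemma map_tensor_axis: "map_tensor f g (axis (i, j) 1) = vtensor (f (axis i 1)) (g (axis j 1))"
proof -
  have "map_tensor f g (axis (i, j) 1) =
      (\<Sum>ij\<in>UNIV. if ij = (i, j) then vtensor (f (axis i 1)) (g (axis j 1)) else 0)"
    unfolding map_tensor_def by (rule sum.cong) (auto simp: axis_def)
  then show ?thesis by simp
qed

lemma map_tensor_vtensor:
  assumes f: "linear_map f" and g: "linear_map g"
  shows "map_tensor f g (vtensor v w) = vtensor (f v) (g w)"
proof -
  have lin1: "linear_map (\<lambda>v. map_tensor f g (vtensor v w))"
    and lin2: "linear_map (\<lambda>v. vtensor (f v) (g w))"
    and lin3: "linear_map (\<lambda>w. map_tensor f g (vtensor v w))"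
    and lin4: "linear_map (\<lambda>w. vtensor (f v) (g w))" for v w
    by (simp_all add: linear_mapI vtensor_add_left vtensor_add_right vtensor_scale_left vtensor_scale_right
        linear_map_add[OF map_tensor_linear] linear_map_scale[OF map_tensor_linear]
        linear_map_add[OF f] linear_map_scale[OF f] linear_map_add[OF g] linear_map_scale[OF g])
  have "map_tensor f g (vtensor (axis i 1) w) = vtensor (f (axis i 1)) (g w)" for i
    by (rule linear_map_eq_axis[OF lin3 lin4]) (simp add: vtensor_axis map_tensor_axis)
  then show ?thesis by (rule linear_map_eq_axis[OF lin1 lin2])
qed

lemma map_tensor_eqI:
  assumes "linear_map F" "linear_map G"
    and "\<And>v w. F (vtensor v w) = G (vtensor v w)"
  shows "F u = G u"
proof (rule linear_map_eq_axis[OF assms(1,2)])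
  show "F (axis ij 1) = G (axis ij 1)" for ij
    using assms(3)[of "axis (fst ij) 1" "axis (snd ij) 1"] by (simp add: vtensor_axis)
qed

lemma map_tensor_arith:
  assumes "linear_map f" "linear_map f'" "linear_map g" "linear_map g'"
  shows "map_tensor (\<lambda>v. f v + f' v) g u = map_tensor f g u + map_tensor f' g u"
    and "map_tensor f (\<lambda>w. g w + g' w) u = map_tensor f g u + map_tensor f g' u"
    and "map_tensor (\<lambda>v. c *s f v) g u = c *s map_tensor f g u"
    and "map_tensor f (\<lambda>w. c *s g w) u = c *s map_tensor f g u"
  by (simp_all add: map_tensor_def vtensor_add_left vtensor_add_right vtensor_scale_left vtensor_scale_right
      vec.scale_right_distrib sum.distrib vec.scale_sum_right mult.commute)

lemma map_tensor_compose:
  assumes "linear_map f" "linear_map f'" "linear_map g" "linear_map g'"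
  shows "map_tensor (\<lambda>v. f (f' v)) (\<lambda>w. g (g' w)) u = map_tensor f g (map_tensor f' g' u)"
proof (rule map_tensor_eqI[of "map_tensor (\<lambda>v. f (f' v)) (\<lambda>w. g (g' w))"
      "\<lambda>u. map_tensor f g (map_tensor f' g' u)"])
  have lin: "linear_map (\<lambda>v. f (f' v))" "linear_map (\<lambda>w. g (g' w))"
    using Vector_Spaces.linear_compose[OF assms(2,1)] Vector_Spaces.linear_compose[OF assms(4,3)]
    by (simp_all add: comp_def)
  show "linear_map (map_tensor (\<lambda>v. f (f' v)) (\<lambda>w. g (g' w)))" by (rule map_tensor_linear)
  show "linear_map (\<lambda>u. map_tensor f g (map_tensor f' g' u))"
    using Vector_Spaces.linear_compose[OF map_tensor_linear[of f' g'] map_tensor_linear[of f g]]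
    by (simp add: comp_def)
  show "map_tensor (\<lambda>v. f (f' v)) (\<lambda>w. g (g' w)) (vtensor v w) =
      map_tensor f g (map_tensor f' g' (vtensor v w))" for v w
    by (simp only: map_tensor_vtensor lin assms)
qed

lemma map_tensor_id: "map_tensor (\<lambda>v. v) (\<lambda>w. w) u = u"
  unfolding map_tensor_def by (simp only: vtensor_axis prod.collapse basis_expansion)

definition pure_act ::
    "('k::field, 'n::finite) D4_module \<Rightarrow> ('k, 'm::finite) D4_module \<Rightarrow> 'k D4 pure \<Rightarrow> 'k^('n \<times> 'm) \<Rightarrow> 'k^('n \<times> 'm)" where
  "pure_act M N u = (case u of Pure x y \<Rightarrow> map_tensor (act M x) (act N y))"

lemma pure_act_action: "monoid_action (pure_act M N)"
  unfolding monoid_action_def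
proof (intro conjI allI)
  show "linear_map (pure_act M N u)" for u
    by (cases u) (simp add: pure_act_def map_tensor_linear)
  show "pure_act M N 0 v = v" for v
    by (simp add: pure_act_def zero_pure_def act_fun map_tensor_id)
  show "pure_act M N (u + w) v = pure_act M N u (pure_act M N w v)" for u w v
    by (cases u; cases w)
      (simp add: pure_act_def act_fun map_tensor_compose[OF act_linear act_linear act_linear act_linear])
qed

text \<open>The action of \<open>D\<^sub>4 \<otimes> D\<^sub>4\<close> with \<open>(x \<otimes> y)(v \<otimes> w) = xv \<otimes> yw\<close>.\<close>

lift_definition tensor_act ::
    "('k::field, 'n::finite) D4_module \<Rightarrow> ('k, 'm::finite) D4_module \<Rightarrow> 'k D4_tensor \<Rightarrow> 'k^('n \<times> 'm) \<Rightarrow> 'k^('n \<times> 'm)"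
  is "\<lambda>M N. pm_act (pure_act M N)"
proof (rule ext, rule pm_act_ideal_cong[OF pure_act_action])
  fix M :: "('k, 'n) D4_module" and N :: "('k, 'm) D4_module" and r :: "'k D4 pure \<Rightarrow>\<^sub>0 'k" and v
  assume "r \<in> bilinear_relations"
  note arith = map_tensor_arith[OF act_linear act_linear act_linear act_linear]
  show "pm_act (pure_act M N) r v = 0"
    using \<open>r \<in> bilinear_relations\<close>
    unfolding bilinear_relations_def
    by (elim UnE CollectE exE conjE)
      (simp_all add: pm_act_add pm_act_diff pm_act_single pure_act_def act_fun arith)
qed assumption

lemma tensor_act_pure: "tensor_act M N (x \<otimes> y) (vtensor v w) = vtensor (act M x v) (act N y w)"
  by transfer (simp add: pm_act_single pure_act_def map_tensor_vtensor[OF act_linear act_linear])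

lemma tensor_act_add: "tensor_act M N (x + y) u = tensor_act M N x u + tensor_act M N y u"
  by transfer (rule pm_act_add)

lemma tensor_act_mult: "tensor_act M N (x * y) u = tensor_act M N x (tensor_act M N y u)"
  by transfer (rule pm_act_mult[OF pure_act_action])

lemma tensor_act_one: "tensor_act M N 1 u = u"
  by transfer (rule pm_act_one[OF pure_act_action])

lemma tensor_act_linear: "linear_map (tensor_act M N x)"
  by transfer (rule pm_act_linear[OF pure_act_action])

lemma tensor_act_scalar: "tensor_act M N (tensor_scalar c) u = c *s u"
  by transfer (simp add: pm_act_single pure_act_def zero_pure_def act_fun map_tensor_id)

definition tensor_module ::
    "('k::field, 'n::finite) D4_module \<Rightarrow> ('k, 'm::finite) D4_module \<Rightarrow> ('k, 'n \<times> 'm) D4_module"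
    (infixr "\<otimes>\<^sub>D" 75) where
  "M \<otimes>\<^sub>D N = Abs_D4_module (\<lambda>x. tensor_act M N (comult x))"

lemma act_tensor_module: "act (M \<otimes>\<^sub>D N) x = tensor_act M N (comult x)"
proof -
  have "is_D4_action (\<lambda>x. tensor_act M N (comult x))"
    by (simp add: is_D4_action_def comult_add comult_mult comult_one comult_scalar tensor_act_add
        tensor_act_mult tensor_act_one tensor_act_scalar linear_map_add[OF tensor_act_linear])
  then show ?thesis by (simp add: tensor_module_def Abs_D4_module_inverse)
qed

lemma act_tensor_module_gen:
  "act (M \<otimes>\<^sub>D N) (D4_gen A) (vtensor v w) =
     vtensor (act M (D4_gen A) v) (act N (D4_gen B) w) + vtensor v (act N (D4_gen A) w)"
  "act (M \<otimes>\<^sub>D N) (D4_gen B) (vtensor v w) = vtensor (act M (D4_gen B) v) (act N (D4_gen B) w)"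
  "act (M \<otimes>\<^sub>D N) (D4_gen C) (vtensor v w) = vtensor (act M (D4_gen C) v) (act N (D4_gen C) w)"
  "act (M \<otimes>\<^sub>D N) (D4_gen D) (vtensor v w) =
     vtensor (act M (D4_gen D) v) (act N (D4_gen C) w) + vtensor v (act N (D4_gen D) w)"
  by (simp_all add: act_tensor_module comult_of_gen comult_gen_def Let_def tensor_act_add tensor_act_pure act_one)

subsection \<open>Modules given by the action of the generators on a basis\<close>

definition gen_act :: "'k^'n^'n \<Rightarrow> 'k::field^'n \<Rightarrow> 'k^'n::finite" where
  "gen_act T v = (\<Sum>i\<in>UNIV. v $ i *s (T $ i))"

definition word_act :: "(gen \<Rightarrow> 'k^'n^'n) \<Rightarrow> word \<Rightarrow> 'k::field^'n \<Rightarrow> 'k^'n::finite" where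
  "word_act T w = foldr (\<lambda>g. gen_act (T g)) (letters w)"

text \<open>The module with basis \<open>(v\<^sub>i)\<close> on which the generator \<open>g\<close> maps \<open>v\<^sub>i\<close> to the row \<open>T g $ i\<close>; this is
  meaningful only if the relations are respected.\<close>

definition module_of :: "(gen \<Rightarrow> 'k^'n^'n) \<Rightarrow> ('k::field, 'n::finite) D4_module" where
  "module_of T = Abs_D4_module (\<lambda>x. pm_act (word_act T) (rep_D4 x))"

definition respects_relations :: "(gen \<Rightarrow> 'k::field^'n::finite^'n) \<Rightarrow> bool" where
  "respects_relations T \<longleftrightarrow> (\<forall>r\<in>D4_relations. \<forall>v. pm_act (word_act T) r v = 0)"

lemma gen_act_linear: "linear_map (gen_act T)"
  by (rule linear_mapI)
     (simp_all add: gen_act_def vec.scale_left_distrib sum.distrib vec.scale_sum_right)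

lemma gen_act_axis: "gen_act T (axis i 1) = T $ i"
proof -
  have "gen_act T (axis i 1) = (\<Sum>j\<in>UNIV. if j = i then T $ i else 0)"
    unfolding gen_act_def by (rule sum.cong) (auto simp: axis_def)
  then show ?thesis by simp
qed

lemma word_act_action: "monoid_action (word_act T)"
  unfolding monoid_action_def
proof (intro conjI allI)
  have "linear_map (foldr (\<lambda>g. gen_act (T g)) gs)" for gs
  proof (induction gs)
    case Nil
    show ?case by (rule linear_mapI) simp_all
  next
    case (Cons g gs)
    show ?case
      using Vector_Spaces.linear_compose[OF Cons gen_act_linear[of "T g"]] by (simp add: comp_def)
  qed
  then show "linear_map (word_act T u)" for u by (simp add: word_act_def)
qed (simp_all add: word_act_def zero_word_def plus_word_def)

lemma act_module_of_abs:
  assumes "respects_relations T"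
  shows "act (module_of T) (abs_D4 p) = pm_act (word_act T) p"
proof -
  note h = word_act_action[of T]
  have F: "pm_act (word_act T) (rep_D4 (abs_D4 p)) v = pm_act (word_act T) p v" for p v
    using assms Quotient3_rep_abs[OF Quotient3_D4, of p]
    by (intro pm_act_ideal_cong[OF h, of D4_relations])
      (auto simp: respects_relations_def ideal_cong_def ideal.zero)
  have "is_D4_action (\<lambda>x. pm_act (word_act T) (rep_D4 x))"
    unfolding is_D4_action_def
  proof (intro conjI allI)
    fix x y :: "'a D4" and v w :: "'a^'b" and c
    obtain p q where xy: "x = abs_D4 p" "y = abs_D4 q"
      by (metis Quotient3_D4 Quotient3_abs_rep)
    show "pm_act (word_act T) (rep_D4 x) (v + w) = pm_act (word_act T) (rep_D4 x) v + pm_act (word_act T) (rep_D4 x) w"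
      by (rule linear_map_add[OF pm_act_linear[OF h]])
    show "pm_act (word_act T) (rep_D4 (x + y)) v = pm_act (word_act T) (rep_D4 x) v + pm_act (word_act T) (rep_D4 y) v"
      by (simp add: xy plus_D4.abs_eq F pm_act_add)
    show "pm_act (word_act T) (rep_D4 (x * y)) v = pm_act (word_act T) (rep_D4 x) (pm_act (word_act T) (rep_D4 y) v)"
      by (simp add: xy times_D4.abs_eq F pm_act_mult[OF h])
    show "pm_act (word_act T) (rep_D4 1) v = v"
      by (simp add: one_D4.abs_eq F pm_act_one[OF h])
    show "pm_act (word_act T) (rep_D4 (D4_scalar c)) v = c *s v"
      by (simp add: D4_scalar.abs_eq F pm_act_single word_act_def zero_word_def)
  qed
  then show ?thesis by (auto simp: module_of_def Abs_D4_module_inverse F)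
qed

lemma act_module_of_gen:
  assumes "respects_relations T"
  shows "act (module_of T) (D4_gen g) = gen_act (T g)"
  unfolding D4_gen.abs_eq act_module_of_abs[OF assms]
  by (rule ext) (simp add: pm_act_single word_act_def)

lemma respects_relationsI:
  fixes T :: "gen \<Rightarrow> 'k::field^'n::finite^'n"
  defines "a \<equiv> gen_act (T A)" and "b \<equiv> gen_act (T B)" and "c \<equiv> gen_act (T C)" and "d \<equiv> gen_act (T D)"
  assumes "\<forall>i. b (a (axis i 1)) = - a (b (axis i 1))" "\<forall>i. d (b (axis i 1)) = - b (d (axis i 1))"
    "\<forall>i. c (a (axis i 1)) = - a (c (axis i 1))" "\<forall>i. d (c (axis i 1)) = - c (d (axis i 1))"
    "\<forall>i. b (c (axis i 1)) = c (b (axis i 1))" "\<forall>i. a (a (axis i 1)) = 0" "\<forall>i. b (b (axis i 1)) = axis i 1"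
    "\<forall>i. c (c (axis i 1)) = axis i 1" "\<forall>i. d (d (axis i 1)) = 0"
    "\<forall>i. d (a (axis i 1)) + a (d (axis i 1)) = axis i 1 - b (c (axis i 1))"
  shows "respects_relations T"
  unfolding respects_relations_def
proof (intro ballI allI)
  fix r :: "word \<Rightarrow>\<^sub>0 'k" and v assume r: "r \<in> D4_relations"
  note h = word_act_action[of T]
  have letter: "pm_act (word_act T) (letter g) = gen_act (T g)" for g
    by (rule ext) (simp add: pm_act_single word_act_def)
  note eqs = assms(5-14)[unfolded assms(1-4), rule_format]
  have zero: "linear_map (\<lambda>v. 0)" by (rule linear_mapI) simp_all
  have "pm_act (word_act T) r (axis i 1) = 0" for i
    using r unfolding D4_relations_def Let_def
    by (elim insertE emptyE)
      (simp_all only: pm_act_add pm_act_diff pm_act_uminus pm_act_mult[OF h] pm_act_one[OF h] pm_act_zero letter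
        eqs diff_self diff_zero)
  then show "pm_act (word_act T) r v = 0"
    by (rule linear_map_eq_axis[OF pm_act_linear[OF h] zero])
qed

text \<open>The sign \<open>(-1)\<^sup>r\<close> for \<open>r\<close> in \<open>\<int>/2\<int>\<close>.\<close>

definition minus_one_power :: "bit \<Rightarrow> 'k::field" where
  "minus_one_power r = (if r = 0 then 1 else - 1)"

abbreviation bvec :: "'n \<Rightarrow> 'k::field^'n::finite" where
  "bvec i \<equiv> axis i 1"

text \<open>\<open>V(r)\<close>, \<open>V(2,r)\<close> and \<open>P(r)\<close>; the basis vector \<open>v\<^sub>i\<close> is \<open>bvec i\<close>, and the \<open>i\<close>-th entry of
  each list is the image of \<open>v\<^sub>i\<close>.\<close>

fun V1_table :: "bit \<Rightarrow> gen \<Rightarrow> 'k::field^1^1" where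
  "V1_table r A = vector [0]"
| "V1_table r B = vector [minus_one_power r *s bvec 1]"
| "V1_table r C = vector [minus_one_power r *s bvec 1]"
| "V1_table r D = vector [0]"

fun V2_table :: "bit \<Rightarrow> gen \<Rightarrow> 'k::field^2^2" where
  "V2_table r A = vector [bvec 2, 0]"
| "V2_table r B = vector [minus_one_power r *s bvec 1, minus_one_power (r + 1) *s bvec 2]"
| "V2_table r C = vector [minus_one_power (r + 1) *s bvec 1, minus_one_power r *s bvec 2]"
| "V2_table r D = vector [0, 2 *s bvec 1]"

fun P_table :: "bit \<Rightarrow> gen \<Rightarrow> 'k::field^4^4" where
  "P_table r A = vector [bvec 2, 0, bvec 4, 0]"
| "P_table r B = vector [minus_one_power r *s bvec 1, minus_one_power (r + 1) *s bvec 2,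
                         minus_one_power (r + 1) *s bvec 3, minus_one_power r *s bvec 4]"
| "P_table r C = vector [minus_one_power r *s bvec 1, minus_one_power (r + 1) *s bvec 2,
                         minus_one_power (r + 1) *s bvec 3, minus_one_power r *s bvec 4]"
| "P_table r D = vector [bvec 3, - bvec 4, 0, 0]"

definition V1 :: "bit \<Rightarrow> ('k::field, 1) D4_module" where "V1 r = module_of (V1_table r)"
definition V2 :: "bit \<Rightarrow> ('k::field, 2) D4_module" where "V2 r = module_of (V2_table r)"
definition P :: "bit \<Rightarrow> ('k::field, 4) D4_module" where "P r = module_of (P_table r)"

lemma vector_4 [simp]:
  "(vector [w, x, y, z] :: 'a::zero^4) $ 1 = w" "(vector [w, x, y, z] :: 'a^4) $ 2 = x"
  "(vector [w, x, y, z] :: 'a^4) $ 3 = y" "(vector [w, x, y, z] :: 'a^4) $ 4 = z"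
  by (simp_all add: vector_def)

lemmas gen_act_arith = linear_map_scale[OF gen_act_linear] linear_map_zero[OF gen_act_linear]
  vec.linear_neg[OF gen_act_linear] gen_act_axis

lemma minus_one_power_simps [simp]:
  "minus_one_power 0 = 1" "minus_one_power 1 = - 1"
  "minus_one_power r * minus_one_power r = 1" "minus_one_power (r + 1) = - minus_one_power r"
  by (cases r; simp add: minus_one_power_def)+

lemma V1_respects: "respects_relations (V1_table r)"
  by (cases r; rule respects_relationsI) (simp_all add: forall_1 gen_act_arith vector_1)

lemma V2_respects: "respects_relations (V2_table r)"
  by (cases r; rule respects_relationsI) (simp_all add: forall_2 gen_act_arith vec_eq_iff)

lemma P_respects: "respects_relations (P_table r)"
  by (cases r; rule respects_relationsI) (simp_all add: forall_4 gen_act_arith)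

lemma V1_act: "act (V1 r) (D4_gen g) (bvec i) = V1_table r g $ i"
  and V2_act: "act (V2 r) (D4_gen g) (bvec j) = V2_table r g $ j"
  and P_act: "act (P r) (D4_gen g) (bvec k) = P_table r g $ k"
  by (simp_all add: V1_def V2_def P_def act_module_of_gen V1_respects V2_respects P_respects gen_act_axis)

lemma P_gen_act: "act (P r) (D4_gen g) = gen_act (P_table r g)"
  and V1_gen_act: "act (V1 r) (D4_gen g) = gen_act (V1_table r g)"
  by (simp_all add: P_def V1_def act_module_of_gen P_respects V1_respects)

lemma D4_induct [case_names scalar gen add mult]:
  assumes "\<And>c. Q (D4_scalar c)" "\<And>g. Q (D4_gen g)" "\<And>x y. Q x \<Longrightarrow> Q y \<Longrightarrow> Q (x + y)"
    and "\<And>x y. Q x \<Longrightarrow> Q y \<Longrightarrow> Q (x * y)"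
  shows "Q (x :: 'k::field D4)"
proof -
  have "Q (abs_D4 (Poly_Mapping.single (Word gs) c))" for gs c
  proof (induction gs)
    case Nil
    show ?case using assms(1)[of c] by (simp add: D4_scalar.abs_eq zero_word_def)
  next
    case (Cons g gs)
    have "Poly_Mapping.single (Word (g # gs)) c = letter g * Poly_Mapping.single (Word gs) c"
      by (simp add: mult_single plus_word_def)
    then show ?case
      using assms(4)[OF assms(2) Cons, of g] by (simp add: D4_gen.abs_eq times_D4.abs_eq)
  qed
  then have "Q (abs_D4 p)" for p
    by (induction p rule: poly_mapping_single_induct)
      (metis word.exhaust, metis assms(3) plus_D4.abs_eq)
  then show ?thesis by (metis Quotient3_D4 Quotient3_abs_rep)
qed

lemma D4_homI:
  assumes "linear_map f" "\<And>g v. f (act M (D4_gen g) v) = act N (D4_gen g) (f v)"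
  shows "D4_hom M N f"
proof -
  have "\<forall>v. f (act M x v) = act N x (f v)" for x
    by (induction x rule: D4_induct)
      (simp_all add: act_scalar act_add act_mult assms(2) linear_map_scale[OF assms(1)] linear_map_add[OF assms(1)])
  then show ?thesis using assms(1) by (simp add: D4_hom_def)
qed

subsection \<open>\<open>P(r)\<close> is the projective cover of \<open>V(r)\<close>\<close>

text \<open>The next three lemmas: \<open>P(r) \<rightarrow> V(r)\<close> is a surjective homomorphism, it is essential, and \<open>P(r)\<close> is
  projective.\<close>

definition P_proj :: "'k::field^4 \<Rightarrow> 'k^1" where
  "P_proj v = v $ 1 *s bvec 1"

lemma P_proj_hom: "D4_hom (P r) (V1 r) P_proj"
proof (rule D4_homI)
  show "linear_map P_proj"
    by (rule linear_mapI) (simp_all add: P_proj_def vec.scale_left_distrib)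
  fix g and v :: "'a^4"
  show "P_proj (act (P r) (D4_gen g) v) = act (V1 r) (D4_gen g) (P_proj v)"
    by (cases g)
      (simp_all add: P_gen_act V1_gen_act gen_act_def P_proj_def sum_4 sum_1 vector_1 axis_def vec_eq_iff forall_1)
qed

lemma P_proj_surj: "surj (P_proj :: 'k::field^4 \<Rightarrow> 'k^1)"
proof (rule surjI)
  show "P_proj (y $ 1 *s bvec 1) = y" for y :: "'k^1"
    by (simp add: P_proj_def vec_eq_iff forall_1 axis_def)
qed

lemma P_proj_essential:
  fixes g :: "'k::field^'n::finite \<Rightarrow> 'k^4"
  assumes g: "D4_hom M (P r) g" and surj: "surj (P_proj \<circ> g)"
  shows "surj g"
proof -
  define U where "U = range g"
  have lin: "linear_map g" and hom: "\<And>x v. g (act M x v) = act (P r) x (g v)"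
    using g unfolding D4_hom_def by blast+
  have add: "u + w \<in> U" if "u \<in> U" "w \<in> U" for u w
    using that linear_map_add[OF lin] unfolding U_def by (metis (no_types, opaque_lifting) imageE rangeI)
  have scale: "c *s u \<in> U" if "u \<in> U" for c u
    using that linear_map_scale[OF lin] unfolding U_def by (metis (no_types, opaque_lifting) imageE rangeI)
  have gens: "gen_act (P_table r h) u \<in> U" if "u \<in> U" for h u
    using that hom[of "D4_gen h"] unfolding U_def P_gen_act by (metis (no_types, opaque_lifting) imageE rangeI)
  obtain v where "P_proj (g v) = bvec 1"
    using surj unfolding surj_def comp_def by metis
  define u where "u = g v"
  have u: "u \<in> U" "u $ 1 = 1"
    using \<open>P_proj (g v) = bvec 1\<close> by (auto simp: U_def u_def P_proj_def vec_eq_iff forall_1 axis_def)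
  have "gen_act (P_table r A) (gen_act (P_table r D) u) = bvec 4"
    by (simp add: gen_act_def sum_4 u axis_def vec_eq_iff forall_4)
  then have e4: "bvec 4 \<in> U" using gens u by metis
  have "gen_act (P_table r A) u + (- (u $ 3)) *s bvec 4 = bvec 2"
    by (simp add: gen_act_def sum_4 u axis_def vec_eq_iff forall_4)
  then have e2: "bvec 2 \<in> U" using gens u add scale e4 by metis
  have "gen_act (P_table r D) u + u $ 2 *s bvec 4 = bvec 3"
    by (simp add: gen_act_def sum_4 u axis_def vec_eq_iff forall_4)
  then have e3: "bvec 3 \<in> U" using gens u add scale e4 by metis
  have "u + ((- (u $ 2)) *s bvec 2 + ((- (u $ 3)) *s bvec 3 + (- (u $ 4)) *s bvec 4)) = bvec 1"
    by (simp add: u axis_def vec_eq_iff forall_4)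
  then have e1: "bvec 1 \<in> U" using u add scale e2 e3 e4 by metis
  have "w \<in> U" for w
  proof -
    have "w = w $ 1 *s bvec 1 + (w $ 2 *s bvec 2 + (w $ 3 *s bvec 3 + w $ 4 *s bvec 4))"
      by (simp add: axis_def vec_eq_iff forall_4)
    then show ?thesis using add scale e1 e2 e3 e4 by metis
  qed
  then show ?thesis unfolding U_def by blast
qed

lemma two_nonzero:
  assumes "CHAR('k::field) \<noteq> 2"
  shows "(2 :: 'k) \<noteq> 0"
proof
  assume "(2 :: 'k) = 0"
  then have "of_nat 2 = (0 :: 'k)" by simp
  then have "CHAR('k) dvd 2" by (simp only: of_nat_eq_0_iff_char_dvd)
  then have "CHAR('k) = 1"
    using assms by (metis two_is_prime_nat prime_nat_iff)
  then have "of_nat 1 = (0 :: 'k)" by (simp only: of_nat_eq_0_iff_char_dvd) simp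
  then show False by simp
qed

lemma P_projective:
  fixes M :: "('k::field, 'n::finite) D4_module" and N :: "('k, 'm::finite) D4_module"
  assumes char: "CHAR('k) \<noteq> 2"
    and g: "D4_hom M N g" "surj g" and f: "D4_hom (P r) N f"
  obtains h where "D4_hom (P r) M h" "\<And>v. g (h v) = f v"
proof -
  define s :: 'k where "s = minus_one_power r"
  have ss: "s * s = 1" "s * (s * x) = x" for x by (simp_all add: s_def flip: mult.assoc)
  have two: "(2 :: 'k) \<noteq> 0" by (rule two_nonzero[OF char])
  have half: "2 * ((1/2) *s x) = x" for x :: "'k^'l::finite"
    using two by (simp add: vec_eq_iff)
  have gl: "linear_map g" and gh: "g (act M x v) = act N x (g v)" for x v
    using g unfolding D4_hom_def by blast+
  have fl: "linear_map f" and fh: "f (act (P r) x v) = act N x (f v)" for x v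
    using f unfolding D4_hom_def by blast+
  define a b c d where abcd: "a = act M (D4_gen A)" "b = act M (D4_gen B)"
    "c = act M (D4_gen C)" "d = act M (D4_gen D)"
  note rels = act_relations[of M, folded abcd]
  have abcd_lin: "linear_map a" "linear_map b" "linear_map c" "linear_map d"
    unfolding abcd by (rule act_linear)+
  note lin = abcd_lin[THEN linear_map_add] abcd_lin[THEN linear_map_scale]
    abcd_lin[THEN linear_map_zero] abcd_lin[THEN vec.linear_neg]
  note lin_gf = linear_map_add[OF gl] linear_map_scale[OF gl] linear_map_add[OF fl] linear_map_scale[OF fl]

  text \<open>Lift \<open>f v\<^sub>1\<close> to \<open>M\<close> and project the lift to the common eigenspace of \<open>b\<close> and \<open>c\<close>.\<close>
  obtain m where m: "g m = f (bvec 1)" using g(2) by (metis surjD)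
  define m1 where "m1 = (1/2) *s (m + s *s b m)"
  define m2 where "m2 = (1/2) *s (m1 + s *s c m1)"
  have fe: "act N (D4_gen B) (f (bvec 1)) = s *s f (bvec 1)" "act N (D4_gen C) (f (bvec 1)) = s *s f (bvec 1)"
    by (simp_all add: s_def P_act lin_gf flip: fh)
  have bm1: "b m1 = s *s m1"
    by (simp add: m1_def lin rels vec.scale_right_distrib ss add.commute mult.left_commute)
  have bm: "b m2 = s *s m2"
    by (simp add: m2_def lin rels(5) bm1 vec.scale_right_distrib mult.left_commute)
  have cm: "c m2 = s *s m2"
    by (simp add: m2_def lin rels vec.scale_right_distrib ss add.commute mult.left_commute)
  have "g m1 = f (bvec 1)"
    by (simp add: m1_def lin_gf m abcd gh fe ss half)
  then have gm: "g m2 = f (bvec 1)"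
    by (simp add: m2_def lin_gf abcd gh fe ss half)
  have da: "d (a v) = v - b (c v) - a (d v)" for v
    using rels(10)[of v] by (simp add: eq_diff_eq)
  have bd: "b (d v) = - d (b v)" and cd: "c (d v) = - d (c v)" for v
    using rels(2,4)[of v] by simp_all

  define h where "h v = v $ 1 *s m2 + v $ 2 *s a m2 + v $ 3 *s d m2 + v $ 4 *s a (d m2)" for v :: "'k^4"
  have hl: "linear_map h"
    by (rule linear_mapI) (simp_all add: h_def vec.scale_left_distrib vec.scale_right_distrib)
  have he: "h (bvec 1) = m2" "h (bvec 2) = a m2" "h (bvec 3) = d m2" "h (bvec 4) = a (d m2)"
    by (simp_all add: h_def axis_def)
  note h_lin = linear_map_scale[OF hl] linear_map_zero[OF hl] vec.linear_neg[OF hl]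
  have hom: "h (act (P r) (D4_gen k) v) = act M (D4_gen k) (h v)" for k v
  proof (rule linear_map_eq_axis[of "\<lambda>v. h (act (P r) (D4_gen k) v)" "\<lambda>v. act M (D4_gen k) (h v)"])
    show "linear_map (\<lambda>v. h (act (P r) (D4_gen k) v))" "linear_map (\<lambda>v. act M (D4_gen k) (h v))"
      using Vector_Spaces.linear_compose[OF act_linear hl] Vector_Spaces.linear_compose[OF hl act_linear]
      by (simp_all add: comp_def)
    show "h (act (P r) (D4_gen k) (bvec i)) = act M (D4_gen k) (h (bvec i))" for i
      using exhaust_4[of i]
      by (cases k) (auto simp: P_act h_lin he lin rels(1,3,6,9) bd cd da bm cm s_def
          simp flip: abcd)
  qed
  show thesis
  proof
    show "D4_hom (P r) M h" by (rule D4_homI[OF hl hom])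
    show "g (h v) = f v" for v
    proof (rule linear_map_eq_axis[of "\<lambda>v. g (h v)" f])
      show "linear_map (\<lambda>v. g (h v))"
        using Vector_Spaces.linear_compose[OF hl gl] by (simp add: comp_def)
      have "f (bvec 2) = act N (D4_gen A) (f (bvec 1))" "f (bvec 3) = act N (D4_gen D) (f (bvec 1))"
        "f (bvec 4) = act N (D4_gen A) (act N (D4_gen D) (f (bvec 1)))"
        by (simp_all add: P_act flip: fh)
      then show "g (h (bvec i)) = f (bvec i)" for i
        using exhaust_4[of i] by (auto simp: he abcd gh gm)
    qed (rule fl)
  qed
qed

end

theory Submission
  imports Defs
begin

text \<open>Write \<open>e\<^sub>i\<^sub>j = v\<^sub>i \<otimes> v\<^sub>j\<close> and \<open>t = (-1)\<^bsup>r'\<^esup>\<close>. The vector \<open>e\<^sub>1\<^sub>2\<close> generates the tensor product: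
  \<open>a e\<^sub>1\<^sub>2 = -t e\<^sub>2\<^sub>2\<close>, \<open>d e\<^sub>1\<^sub>2 = 2 e\<^sub>1\<^sub>1\<close> and \<open>a d e\<^sub>1\<^sub>2 = 2 e\<^sub>1\<^sub>2 + 2 t e\<^sub>2\<^sub>1\<close>. Together with \<open>e\<^sub>1\<^sub>2\<close> these form
  a basis because \<open>2 \<noteq> 0\<close>, and the generators act on it as on the basis \<open>v\<^sub>1, v\<^sub>2, v\<^sub>3, v\<^sub>4\<close> of
  \<open>P(r + r' + 1)\<close>.\<close>

text \<open>For 2 \<noteq> 0, these are the coordinates of \<open>u\<close> in the basis above,
  using \<open>1 / t = t\<close>.\<close>

definition V2_tensor_to_P :: "bit \<Rightarrow> 'k::field^(2 \<times> 2) \<Rightarrow> 'k^4" where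
  "V2_tensor_to_P r' u = (let t = minus_one_power r' in
     vector [u $ (1, 2) - t * u $ (2, 1), - t * u $ (2, 2), u $ (1, 1) / 2, t * u $ (2, 1) / 2])"

definition P_to_V2_tensor :: "bit \<Rightarrow> 'k::field^4 \<Rightarrow> 'k^(2 \<times> 2)" where
  "P_to_V2_tensor r' v = (let t = minus_one_power r' in
     v $ 1 *s bvec (1, 2) + (- t * v $ 2) *s bvec (2, 2) + (2 * v $ 3) *s bvec (1, 1)
       + v $ 4 *s (2 *s bvec (1, 2) + (2 * t) *s bvec (2, 1)))"

lemma forall_2x2: "(\<forall>ij :: 2 \<times> 2. Q ij) \<longleftrightarrow> Q (1, 1) \<and> Q (1, 2) \<and> Q (2, 1) \<and> Q (2, 2)"
  by (simp add: split_paired_All forall_2 conj_assoc)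

lemma V2_tensor_to_P_vtensor:
  "V2_tensor_to_P r' (vtensor v w) = (let t = minus_one_power r' in
     vector [v $ 1 * w $ 2 - t * (v $ 2 * w $ 1), - t * (v $ 2 * w $ 2),
       v $ 1 * w $ 1 / 2, t * (v $ 2 * w $ 1) / 2])"
  by (simp add: V2_tensor_to_P_def vtensor_def)

lemma V2_tensor_to_P_linear: "linear_map (V2_tensor_to_P r')"
  by (rule linear_mapI)
    (simp_all add: V2_tensor_to_P_def Let_def vec_eq_iff forall_4 add_divide_distrib distrib_left algebra_simps)

text \<open>Inverting the change of basis uses only \<open>t * t = 1\<close> and division by
  2.\<close>

lemma V2_tensor_to_P_bij:
  assumes "(2 :: 'k::field) \<noteq> 0"
  shows "bij (V2_tensor_to_P r' :: 'k^(2 \<times> 2) \<Rightarrow> 'k^4)"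
proof (rule o_bij)
  show "P_to_V2_tensor r' \<circ> V2_tensor_to_P r' = (id :: 'k^(2 \<times> 2) \<Rightarrow> _)"
    using assms by (cases r')
      (simp_all add: fun_eq_iff P_to_V2_tensor_def V2_tensor_to_P_def Let_def vec_eq_iff forall_2x2 axis_def
        del: split_paired_All)
  show "V2_tensor_to_P r' \<circ> P_to_V2_tensor r' = (id :: 'k^4 \<Rightarrow> _)"
    using assms by (cases r')
      (simp_all add: fun_eq_iff P_to_V2_tensor_def V2_tensor_to_P_def Let_def vec_eq_iff forall_4 axis_def)
qed

text \<open>The index \<open>r + r' + 1\<close> is the parity of the generator: \<open>b\<close> and
  \<open>c\<close> both scale \<open>e\<^sub>1\<^sub>2\<close> by
  \<open>minus_one_power (r + r' + 1)\<close>.\<close>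

lemma V2_tensor_to_P_hom:
  assumes two: "(2 :: 'k::field) \<noteq> 0"
  shows "D4_hom (V2 r \<otimes>\<^sub>D V2 r' :: ('k, 2 \<times> 2) D4_module) (P (r + r' + 1)) (V2_tensor_to_P r')"
proof (rule D4_homI)
  let ?f = "V2_tensor_to_P r' :: 'k^(2 \<times> 2) \<Rightarrow> 'k^4"
  let ?M = "V2 r \<otimes>\<^sub>D V2 r' :: ('k, 2 \<times> 2) D4_module"
  let ?N = "P (r + r' + 1) :: ('k, 4) D4_module"
  show f: "linear_map ?f" by (rule V2_tensor_to_P_linear)
  show "?f (act ?M (D4_gen g) u) = act ?N (D4_gen g) (?f u)" for g u
  proof (rule linear_map_eq_axis[of "\<lambda>u. ?f (act ?M (D4_gen g) u)" "\<lambda>u. act ?N (D4_gen g) (?f u)"])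
    show "linear_map (\<lambda>u. ?f (act ?M (D4_gen g) u))" "linear_map (\<lambda>u. act ?N (D4_gen g) (?f u))"
      using Vector_Spaces.linear_compose[OF act_linear f] Vector_Spaces.linear_compose[OF f act_linear]
      by (simp_all add: comp_def)
    \<comment> \<open>Basis vectors are written as pure tensors, where the comultiplication gives
      the action.\<close>
    have "\<forall>i j. ?f (act ?M (D4_gen g) (vtensor (bvec i) (bvec j)))
        = act ?N (D4_gen g) (?f (vtensor (bvec i) (bvec j)))"
      using two
      by (cases g; cases r; cases r';
          simp add: act_tensor_module_gen V2_act P_gen_act linear_map_add[OF V2_tensor_to_P_linear];
          simp add: V2_tensor_to_P_vtensor forall_2 gen_act_def sum_4 vec_eq_iff forall_4 axis_def)
    then show "?f (act ?M (D4_gen g) (bvec ij)) = act ?N (D4_gen g) (?f (bvec ij))" for ij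
      by (cases ij) (simp add: vtensor_axis)
  qed
qed

theorem proposition2p5:
  fixes r r' :: bit
  assumes "CHAR('k::alg_closed_field) \<noteq> 2"
  shows "(V2 r \<otimes>\<^sub>D V2 r' :: ('k, 2 \<times> 2) D4_module) \<cong>\<^sub>D (P (r + r' + 1) :: ('k, 4) D4_module)"
  unfolding D4_isomorphic_def
  using V2_tensor_to_P_hom V2_tensor_to_P_bij two_nonzero[OF assms] by blast

end
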